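(* (1) No order-based semantics is $\cdot$-composable. (2) No identifier-independent, unbounded, filter-based semantics is $\cdot$-composable.
   Context: Fix pairwise disjoint countably infinite sets $\mathbb V$ (vertex identifiers), $\mathbb E$ (edge identifiers), $\mathbb L$ (labels). Regular expressions are given by $R ::= \varepsilon \mid a \mid R^* \mid R\cdot R\mid R+R$ with $a\in\mathbb L$; $L(R)$ is the denoted language. A walk is a finite nonempty alternating sequence $w=(v_0,e_1,v_1,\dots,e_k,v_k)$ with $v_i\in\mathbb V$, $e_i\in\mathbb E$; its length is $k$ and its endpoints are the pair $(v_0,v_k)$. $\mathsf{Walks}$ is the set of all walks (independently of any database). Walks $w$ and $w'$ concatenate if the last vertex of $w$ is the first vertex of $w'$; then $w\cdot w'$ is obtained by joining them with the shared vertex written once. For sets of walks, $W\cdot W'$ is the set of all $w\cdot w'$ with $w\in W$, $w'\in W'$ that concatenate. A database $D=(L_D,V_D,E_D,\mathsf{Src}_D,\mathsf{Tgt}_D,\mathsf{Lbl}_D)$ consists of finite sets $L_D\subset\mathbb L$, $V_D\subset\mathbb V$, $E_D\subset\mathbb E$ and functions $\mathsf{Src}_D,\mathsf{Tgt}_D:E_D\to V_D$, $\mathsf{Lbl}_D:E_D\to L_D$. $\mathsf{Walks}(D)$ is the set of walks $(v_0,e_1,\dots,e_k,v_k)$ with all $v_i\in V_D$, $e_i\in E_D$, $\mathsf{Src}_D(e_i)=v_{i-1}$ and $\mathsf{Tgt}_D(e_i)=v_i$; the label $\mathsf{Lbl}_D(w)$ of such a walk is the word $\mathsf{Lbl}_D(e_1)\cdots\mathsf{Lbl}_D(e_k)$.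 $\mathsf{Matches}(D,R)=\{w\in\mathsf{Walks}(D): \mathsf{Lbl}_D(w)\in L(R)\}$, and $\mathsf{Matches}(D,R,s,t)$ is the set of those $w\in \mathsf{Matches}(D,R)$ with endpoints $(s,t)$. A semantics $S$ is a function mapping every database $D$ and regular expression $R$ to a finite subset $S(D,R)$ of $\mathsf{Matches}(D,R)$. $S$ is filter-based if there is a function $f:\mathsf{Walks}\to\{\top,\bot\}$ with $S(D,R)=\{w\in\mathsf{Matches}(D,R): f(w)=\top\}$ for all $D,R$. A partial order $\preceq$ on $\mathsf{Walks}$ is suitable if for every database $D$ its restriction to $\mathsf{Walks}(D)$ is a well-partial-order (every infinite sequence $x_1,x_2,\dots$ has $i<j$ with $x_i\preceq x_j$). $S$ is order-based if there is a suitable order $\preceq$ with $S(D,R)=\bigcup_{s,t\in V_D}\min_\preceq \mathsf{Matches}(D,R,s,t)$ for all $D,R$, where $\min_\preceq X$ is the set of $\preceq$-minimal elements of $X$. A renaming is a permutation $\nu$ of $\mathbb V\cup\mathbb E$ with $\nu(\mathbb V)=\mathbb V$ and $\nu(\mathbb E)=\mathbb E$; it acts on walks elementwise and on databases by renaming vertices and edges (transporting source, target and label functions along $\nu$). $S$ is identifier-independent if $\nu(S(D,R))=S(\nu(D),R)$ for every renaming $\nu$, database $D$ and regular expression $R$. $S$ is unbounded if for every integer $n$ there are $D,R$ such that $S(D,R)$ contains a walk of length at least $n$. $S$ is $\cdot$-composable if $S(D,R\cdot R')\supseteq S(D,R)\cdot S(D,R')$ for all databases $D$ and regular expressions $R,R'$.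 *)

theory Defs
  imports
    "HOL-Library.FuncSet"
    "HOL-Library.Countable"
    "HOL-Library.Infinite_Typeclass"
begin

text \<open>
  The pairwise disjoint sets of vertex identifiers, edge identifiers and labels are rendered as
  three type parameters \<open>'v\<close>, \<open>'e\<close>, \<open>'l\<close>; the theorem constrains each of them to be
  countably infinite by means of the classes \<open>countable\<close> and \<open>infinite\<close>.
\<close>

subsection \<open>Regular expressions\<close>

datatype 'l rexp =
    Eps
  | Atom 'l
  | Star "'l rexp"
  | Times "'l rexp" "'l rexp"
  | Plus "'l rexp" "'l rexp"

primrec lang :: "'l rexp \<Rightarrow> 'l list set" where
  "lang Eps = {[]}"
| "lang (Atom a) = {[a]}"
| "lang (Star R) = {concat us | us. set us \<subseteq> lang R}"
| "lang (Times R R') = {u @ u' | u u'. u \<in> lang R \<and> u' \<in> lang R'}"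
| "lang (Plus R R') = lang R \<union> lang R'"

subsection \<open>Walks\<close>

text \<open>
  The walk $(v_0,e_1,v_1,\dots,e_k,v_k)$ is \<open>Walk v\<^sub>0 [(e\<^sub>1, v\<^sub>1), \<dots>, (e\<^sub>k, v\<^sub>k)]\<close>, so every value of
  the type is a walk, independently of any database.
\<close>

datatype ('v, 'e) walk = Walk (first_vertex: 'v) (steps: "('e \<times> 'v) list")

definition vertices :: "('v, 'e) walk \<Rightarrow> 'v list" where
  "vertices w = first_vertex w # map snd (steps w)"

definition edges :: "('v, 'e) walk \<Rightarrow> 'e list" where
  "edges w = map fst (steps w)"

definition walk_length :: "('v, 'e) walk \<Rightarrow> nat" where
  "walk_length w = length (edges w)"

definition last_vertex :: "('v, 'e) walk \<Rightarrow> 'v" where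
  "last_vertex w = last (vertices w)"

definition endpoints :: "('v, 'e) walk \<Rightarrow> 'v \<times> 'v" where
  "endpoints w = (first_vertex w, last_vertex w)"

definition concatenates :: "('v, 'e) walk \<Rightarrow> ('v, 'e) walk \<Rightarrow> bool" where
  "concatenates w w' \<longleftrightarrow> last_vertex w = first_vertex w'"

text \<open>Only meaningful if \<open>concatenates w w'\<close>.\<close>

definition walk_append :: "('v, 'e) walk \<Rightarrow> ('v, 'e) walk \<Rightarrow> ('v, 'e) walk" where
  "walk_append w w' = Walk (first_vertex w) (steps w @ steps w')"

definition walks_conc :: "('v, 'e) walk set \<Rightarrow> ('v, 'e) walk set \<Rightarrow> ('v, 'e) walk set" where
  "walks_conc W W' = {walk_append w w' | w w'. w \<in> W \<and> w' \<in> W' \<and> concatenates w w'}"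

subsection \<open>Databases\<close>

record ('v, 'e, 'l) database =
  Labels :: "'l set"
  Verts :: "'v set"
  Edges :: "'e set"
  Src :: "'e \<Rightarrow> 'v"
  Tgt :: "'e \<Rightarrow> 'v"
  Lbl :: "'e \<Rightarrow> 'l"

text \<open>
  The extensional function spaces fix the values of the three functions outside the edge set, so
  that databases agreeing as mathematical tuples are equal, and a semantics cannot depend on
  values outside the edge set.
\<close>

definition is_database :: "('v, 'e, 'l) database \<Rightarrow> bool" where
  "is_database D \<longleftrightarrow>
     finite (Labels D) \<and> finite (Verts D) \<and> finite (Edges D) \<and>
     Src D \<in> Edges D \<rightarrow>\<^sub>E Verts D \<and>
     Tgt D \<in> Edges D \<rightarrow>\<^sub>E Verts D \<and>
     Lbl D \<in> Edges D \<rightarrow>\<^sub>E Labels D"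

definition db_walks :: "('v, 'e, 'l) database \<Rightarrow> ('v, 'e) walk set" where
  "db_walks D = {w. set (vertices w) \<subseteq> Verts D \<and> set (edges w) \<subseteq> Edges D \<and>
     (\<forall>i < walk_length w. Src D (edges w ! i) = vertices w ! i \<and>
                          Tgt D (edges w ! i) = vertices w ! Suc i)}"

definition walk_label :: "('v, 'e, 'l) database \<Rightarrow> ('v, 'e) walk \<Rightarrow> 'l list" where
  "walk_label D w = map (Lbl D) (edges w)"

definition Matches :: "('v, 'e, 'l) database \<Rightarrow> 'l rexp \<Rightarrow> ('v, 'e) walk set" where
  "Matches D R = {w \<in> db_walks D. walk_label D w \<in> lang R}"

definition Matches_between ::
    "('v, 'e, 'l) database \<Rightarrow> 'l rexp \<Rightarrow> 'v \<Rightarrow> 'v \<Rightarrow> ('v, 'e) walk set" where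
  "Matches_between D R s t = {w \<in> Matches D R. endpoints w = (s, t)}"

subsection \<open>Semantics\<close>

type_synonym ('v, 'e, 'l) semantics = "('v, 'e, 'l) database \<Rightarrow> 'l rexp \<Rightarrow> ('v, 'e) walk set"

text \<open>
  As \<open>database\<close> is a raw record type, all conditions on a semantics only concern its values at
  arguments satisfying \<open>is_database\<close>.
\<close>

definition is_semantics :: "('v, 'e, 'l) semantics \<Rightarrow> bool" where
  "is_semantics S \<longleftrightarrow> (\<forall>D R. is_database D \<longrightarrow> S D R \<subseteq> Matches D R \<and> finite (S D R))"

definition filter_based :: "('v, 'e, 'l) semantics \<Rightarrow> bool" where
  "filter_based S \<longleftrightarrow>
     (\<exists>f :: ('v, 'e) walk \<Rightarrow> bool. \<forall>D R. is_database D \<longrightarrow> S D R = {w \<in> Matches D R. f w})"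

definition well_partial_order_on :: "'a set \<Rightarrow> 'a rel \<Rightarrow> bool" where
  "well_partial_order_on A r \<longleftrightarrow> partial_order_on A r \<and>
     (\<forall>x :: nat \<Rightarrow> 'a. range x \<subseteq> A \<longrightarrow> (\<exists>i j. i < j \<and> (x i, x j) \<in> r))"

text \<open>
  A pair \<open>(x, y) \<in> r\<close> means that \<open>x\<close> is below \<open>y\<close>. The type argument only names
  the label type of the databases quantified over, which does not occur in the type of \<open>r\<close>.
\<close>

definition suitable :: "'l itself \<Rightarrow> ('v, 'e) walk rel \<Rightarrow> bool" where
  "suitable _ r \<longleftrightarrow> partial_order_on UNIV r \<and>
     (\<forall>D :: ('v, 'e, 'l) database. is_database D \<longrightarrow>
        well_partial_order_on (db_walks D) (Restr r (db_walks D)))"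

definition minimal_elements :: "'a rel \<Rightarrow> 'a set \<Rightarrow> 'a set" where
  "minimal_elements r X = {x \<in> X. \<forall>y \<in> X. (y, x) \<in> r \<longrightarrow> y = x}"

definition order_based :: "('v, 'e, 'l) semantics \<Rightarrow> bool" where
  "order_based S \<longleftrightarrow>
     (\<exists>r. suitable TYPE('l) r \<and>
        (\<forall>D R. is_database D \<longrightarrow>
           S D R = (\<Union>s \<in> Verts D. \<Union>t \<in> Verts D. minimal_elements r (Matches_between D R s t))))"

text \<open>
  Since vertex and edge identifiers have different types, a renaming amounts to a permutation
  \<open>\<nu>V\<close> of the vertex identifiers together with a permutation \<open>\<nu>E\<close> of the edge identifiers. It acts
  on walks by the map function \<open>map_walk\<close> of the datatype.
\<close>

definition rename_database ::
    "('v \<Rightarrow> 'v) \<Rightarrow> ('e \<Rightarrow> 'e) \<Rightarrow> ('v, 'e, 'l) database \<Rightarrow> ('v, 'e, 'l) database" where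
  "rename_database \<nu>V \<nu>E D =
     \<lparr> Labels = Labels D,
       Verts = \<nu>V ` Verts D,
       Edges = \<nu>E ` Edges D,
       Src = (\<lambda>e \<in> \<nu>E ` Edges D. \<nu>V (Src D (inv \<nu>E e))),
       Tgt = (\<lambda>e \<in> \<nu>E ` Edges D. \<nu>V (Tgt D (inv \<nu>E e))),
       Lbl = (\<lambda>e \<in> \<nu>E ` Edges D. Lbl D (inv \<nu>E e)) \<rparr>"

definition identifier_independent :: "('v, 'e, 'l) semantics \<Rightarrow> bool" where
  "identifier_independent S \<longleftrightarrow>
     (\<forall>\<nu>V \<nu>E D R. bij \<nu>V \<longrightarrow> bij \<nu>E \<longrightarrow> is_database D \<longrightarrow>
        map_walk \<nu>V \<nu>E ` S D R = S (rename_database \<nu>V \<nu>E D) R)"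

definition unbounded :: "('v, 'e, 'l) semantics \<Rightarrow> bool" where
  "unbounded S \<longleftrightarrow>
     (\<forall>n :: int. \<exists>D R. is_database D \<and> (\<exists>w \<in> S D R. int (walk_length w) \<ge> n))"

definition dot_composable :: "('v, 'e, 'l) semantics \<Rightarrow> bool" where
  "dot_composable S \<longleftrightarrow>
     (\<forall>D R R'. is_database D \<longrightarrow> walks_conc (S D R) (S D R') \<subseteq> S D (Times R R'))"

lemma map_walk_Walk: "map_walk f g (Walk v ss) = Walk (f v) (map (map_prod g f) ss)"
  by simp

lemma is_database_rename_database:
  assumes "is_database D" "bij \<nu>V" "bij \<nu>E"
  shows "is_database (rename_database \<nu>V \<nu>E D)"
  using assms
  by (auto simp: is_database_def rename_database_def bij_is_inj PiE_iff)

end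

theory Submission
  imports Defs
begin

text \<open>
  (1) If the edges of a database carry distinct labels, every nonempty walk is the only match of its
  label. Let \<open>w\<close>, \<open>w'\<close> be walks from \<open>u\<close> to \<open>v \<noteq> u\<close>. Adding \<open>\<epsilon>\<close> to the expressions for their labels
  creates no further matches from \<open>u\<close> to \<open>v\<close>, so composability selects both \<open>w\<close> followed by the trivial
  walk at \<open>v\<close> and the trivial walk at \<open>u\<close> followed by \<open>w'\<close>, for one and the same expression. So \<open>w\<close> and
  \<open>w'\<close> are incomparable, which contradicts the well-partial-order property as soon as there are
  infinitely many walks from \<open>u\<close> to \<open>v\<close>.

  (2) The walks accepted by the filter of a composable semantics are closed under concatenation, so
  an accepted closed walk of positive length could be iterated, giving infinitely many results. If an
  accepted walk is not closed, a renaming that swaps its endpoints and makes its edges fresh yields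
  an accepted return walk, and the two together are closed.
\<close>

section \<open>Single-word expressions and walks as step lists\<close>

fun word_rexp :: "'l list \<Rightarrow> 'l rexp" where
  "word_rexp [] = Eps"
| "word_rexp (a # as) = Times (Atom a) (word_rexp as)"

lemma lang_word_rexp [simp]: "lang (word_rexp u) = {u}"
  by (induction u) auto

lemma vertices_Walk [simp]: "vertices (Walk v ss) = v # map snd ss"
  by (simp add: vertices_def)

lemma edges_Walk [simp]: "edges (Walk v ss) = map fst ss"
  by (simp add: edges_def)

lemma walk_length_Walk [simp]: "walk_length (Walk v ss) = length ss"
  by (simp add: walk_length_def)

lemma walk_label_Walk [simp]: "walk_label D (Walk v ss) = map (Lbl D \<circ> fst) ss"
  by (simp add: walk_label_def)

lemma last_vertex_Walk [simp]:
  "last_vertex (Walk v []) = v"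
  "last_vertex (Walk v ((e, u) # ss)) = last_vertex (Walk u ss)"
  by (simp_all add: last_vertex_def)

lemma last_vertex_append:
  "last_vertex (Walk v (ss @ ss')) = last_vertex (Walk (last_vertex (Walk v ss)) ss')"
  by (induction ss arbitrary: v) auto

lemma last_vertex_in_vertices: "last_vertex w \<in> set (vertices w)"
  unfolding last_vertex_def by (rule last_in_set) (simp add: vertices_def)

lemma last_vertex_map_walk: "last_vertex (map_walk g h w) = g (last_vertex w)"
  by (cases w) (simp add: last_vertex_def last_map comp_def)

lemma db_walks_Nil [simp]: "Walk v [] \<in> db_walks D \<longleftrightarrow> v \<in> Verts D"
  by (simp add: db_walks_def)

lemma db_walks_Cons [simp]:
  "Walk v ((e, u) # ss) \<in> db_walks D \<longleftrightarrow>
     v \<in> Verts D \<and> e \<in> Edges D \<and> Src D e = v \<and> Tgt D e = u \<and> Walk u ss \<in> db_walks D"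
  by (auto simp: db_walks_def All_less_Suc2)

lemma db_walks_append:
  assumes "Walk v ss \<in> db_walks D" "Walk (last_vertex (Walk v ss)) ss' \<in> db_walks D"
  shows "Walk v (ss @ ss') \<in> db_walks D"
  using assms by (induction ss arbitrary: v) auto

lemma db_walks_mono:
  assumes "Verts D \<subseteq> Verts D'" "Edges D \<subseteq> Edges D'"
    and "\<And>e. e \<in> Edges D \<Longrightarrow> Src D' e = Src D e" "\<And>e. e \<in> Edges D \<Longrightarrow> Tgt D' e = Tgt D e"
  shows "db_walks D \<subseteq> db_walks D'"
proof
  fix w assume "w \<in> db_walks D"
  then show "w \<in> db_walks D'"
  proof (induction "steps w" arbitrary: w)
    case Nil
    then show ?case using assms by (cases w) auto
  next
    case (Cons p ss)
    obtain v e u where w: "w = Walk v ((e, u) # ss)"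
      using Cons.hyps(2) by (cases w; cases p) auto
    then show ?case using Cons.hyps(1)[of "Walk u ss"] Cons.prems assms by auto
  qed
qed

lemma walk_appendI:
  assumes "w \<in> W" "w' \<in> W'" "last_vertex w = first_vertex w'"
  shows "walk_append w w' \<in> walks_conc W W'"
  using assms by (auto simp: walks_conc_def concatenates_def)

lemma dot_composableD:
  assumes "dot_composable S" "is_database D" "w \<in> S D R" "w' \<in> S D R'"
    and "last_vertex w = first_vertex w'"
  shows "walk_append w w' \<in> S D (Times R R')"
  using assms walk_appendI unfolding dot_composable_def by blast

subsection \<open>Order-based semantics\<close>

text \<open>Every edge of a database determines its target, so the edge sequence fixes all vertices
  after the first. The first vertices may differ when there are no edges.\<close>

lemma steps_eqI:
  assumes "Walk v ss \<in> db_walks D" "Walk v' ss' \<in> db_walks D" "map fst ss = map fst ss'"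
  shows "ss = ss'"
  using assms
proof (induction ss arbitrary: v v' ss')
  case Nil
  then show ?case by simp
next
  case (Cons p ss)
  then show ?case by (cases p; cases ss') auto
qed

text \<open>Injectivity recovers the edges from the label, and the source of the first edge then
  gives the start. The empty label must be excluded because all trivial walks share it.\<close>

lemma walk_eqI_label:
  assumes inj: "inj_on (Lbl D) (Edges D)"
    and w: "w \<in> db_walks D" "w' \<in> db_walks D"
    and lab: "walk_label D w = walk_label D w'" "walk_label D w \<noteq> []"
  shows "w = w'"
proof -
  have "set (edges w) \<union> set (edges w') \<subseteq> Edges D"
    using w by (auto simp: db_walks_def)
  then have "edges w = edges w'"
    using lab inj unfolding walk_label_def by (metis inj_on_map_eq_map inj_on_subset)
  then have ss: "steps w = steps w'"
    using w steps_eqI[of "first_vertex w" "steps w" D "first_vertex w'" "steps w'"]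
    by (simp add: edges_def)
  moreover obtain e u rest where "steps w = (e, u) # rest"
    using lab by (cases w; cases "steps w") auto
  ultimately show ?thesis
    using w by (cases w; cases w') auto
qed

definition represents_order :: "('v, 'e) walk rel \<Rightarrow> ('v, 'e, 'l) semantics \<Rightarrow> bool" where
  "represents_order r S \<longleftrightarrow> (\<forall>D R. is_database D \<longrightarrow>
     S D R = (\<Union>s \<in> Verts D. \<Union>t \<in> Verts D. minimal_elements r (Matches_between D R s t)))"

text \<open>An element without competitors is minimal for whatever order, so nothing about
  \<open>r\<close> has to be known.\<close>

lemma unique_match_selected:
  fixes S :: "('v, 'e, 'l) semantics" and D :: "('v, 'e, 'l) database"
  assumes "represents_order r S" "is_database D" "w \<in> Matches D R"
    and "\<And>y. y \<in> Matches D R \<Longrightarrow> endpoints y = endpoints w \<Longrightarrow> y = w"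
  shows "w \<in> S D R"
proof -
  let ?s = "first_vertex w" and ?t = "last_vertex w"
  have "w \<in> db_walks D" using assms(3) by (simp add: Matches_def)
  then have "?s \<in> Verts D" "?t \<in> Verts D"
    using last_vertex_in_vertices[of w] by (auto simp: db_walks_def vertices_def)
  moreover have "w \<in> minimal_elements r (Matches_between D R ?s ?t)"
    using assms(3,4) by (auto simp: minimal_elements_def Matches_between_def endpoints_def)
  ultimately show ?thesis
    using assms(1,2) unfolding represents_order_def by blast
qed

text \<open>The empty word contributes only trivial walks. These are closed while \<open>w\<close>
  is not, so no two matches have the same endpoints.\<close>

lemma optional_walk_selected:
  fixes S :: "('v, 'e, 'l) semantics" and D :: "('v, 'e, 'l) database"
  assumes S: "represents_order r S" "is_database D" and inj: "inj_on (Lbl D) (Edges D)"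
    and w: "w \<in> db_walks D" "first_vertex w \<noteq> last_vertex w"
    and R: "lang R = {[], walk_label D w}"
  shows "w \<in> S D R" and "x \<in> Verts D \<Longrightarrow> Walk x [] \<in> S D R"
proof -
  have nonempty: "walk_label D w \<noteq> []"
    using w(2) by (cases w) auto
  have cases: "y = w \<or> (\<exists>z. y = Walk z [])" if "y \<in> Matches D R" for y
  proof (cases "walk_label D y = []")
    case True
    then show ?thesis by (cases y) auto
  next
    case False
    then have "walk_label D w = walk_label D y" "y \<in> db_walks D"
      using that R by (auto simp: Matches_def)
    then show ?thesis using walk_eqI_label inj w(1) nonempty by metis
  qed
  show "w \<in> S D R"
  proof (rule unique_match_selected[OF S])
    show "w \<in> Matches D R" using w R by (simp add: Matches_def)
    show "y = w" if "y \<in> Matches D R" "endpoints y = endpoints w" for y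
      using cases[OF that(1)] that(2) w(2) by (auto simp: endpoints_def)
  qed
  show "Walk x [] \<in> S D R" if "x \<in> Verts D"
  proof (rule unique_match_selected[OF S])
    show "Walk x [] \<in> Matches D R" using that R by (simp add: Matches_def)
    show "y = Walk x []" if "y \<in> Matches D R" "endpoints y = endpoints (Walk x [])" for y
      using cases[OF that(1)] that(2) w(2) by (auto simp: endpoints_def)
  qed
qed

lemma composable_order_incomparable:
  fixes S :: "('v, 'e, 'l) semantics" and D :: "('v, 'e, 'l) database"
  assumes S: "represents_order r S" "is_database D" and inj: "inj_on (Lbl D) (Edges D)"
    and dot: "dot_composable S"
    and w: "w \<in> db_walks D" "w' \<in> db_walks D"
    and ends: "endpoints w = (u, v)" "endpoints w' = (u, v)" "u \<noteq> v"
    and le: "(w, w') \<in> r"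
  shows "w = w'"
proof -
  let ?R = "Plus Eps (word_rexp (walk_label D w))"
  let ?R' = "Plus Eps (word_rexp (walk_label D w'))"
  have uv: "first_vertex w = u" "last_vertex w = v" "first_vertex w' = u" "last_vertex w' = v"
    using ends by (auto simp: endpoints_def)
  have verts: "u \<in> Verts D" "v \<in> Verts D"
    using w(1) last_vertex_in_vertices[of w] uv by (auto simp: db_walks_def vertices_def)
  have sel: "w \<in> S D ?R" "Walk u [] \<in> S D ?R" "w' \<in> S D ?R'" "Walk v [] \<in> S D ?R'"
    using optional_walk_selected[OF S inj, of w ?R] optional_walk_selected[OF S inj, of w' ?R']
      w uv ends(3) verts by auto
  have "walk_append w (Walk v []) \<in> S D (Times ?R ?R')"
    using dot_composableD[OF dot S(2) sel(1) sel(4)] uv by simp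
  moreover have "walk_append w (Walk v []) = w"
    by (cases w) (simp add: walk_append_def)
  ultimately have "w \<in> S D (Times ?R ?R')" by simp
  moreover have "walk_append (Walk u []) w' \<in> S D (Times ?R ?R')"
    using dot_composableD[OF dot S(2) sel(2) sel(3)] uv by simp
  moreover have "walk_append (Walk u []) w' = w'"
    using uv by (cases w') (simp add: walk_append_def)
  ultimately have "w \<in> S D (Times ?R ?R')" "w' \<in> S D (Times ?R ?R')" by simp_all
  \<comment> \<open>Both walks are now minimal in one set of matches from \<open>u\<close> to
    \<open>v\<close>; minimality of \<open>w'\<close> turns \<open>(w, w') \<in> r\<close> into
    equality.\<close>
  then show ?thesis
    using S le ends by (auto simp: represents_order_def minimal_elements_def Matches_between_def)
qed

lemma two_distinct_elements:
  obtains x y :: "'a :: infinite" where "x \<noteq> y"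
  using ex_new_if_finite[OF infinite_UNIV, of "{undefined :: 'a}"] by auto

lemma order_based_not_composable:
  fixes S :: "('v :: infinite, 'e :: infinite, 'l :: infinite) semantics"
  assumes "order_based S"
  shows "\<not> dot_composable S"
proof
  assume dot: "dot_composable S"
  obtain r where suit: "suitable TYPE('l) r" and S: "represents_order r S"
    using assms by (auto simp: order_based_def represents_order_def)
  obtain u v :: 'v where uv: "u \<noteq> v" by (rule two_distinct_elements)
  obtain c d :: 'e where cd: "c \<noteq> d" by (rule two_distinct_elements)
  obtain a b :: 'l where ab: "a \<noteq> b" by (rule two_distinct_elements)
  \<comment> \<open>A loop \<open>d\<close> at \<open>u\<close> and an edge \<open>c\<close> from
    \<open>u\<close> to \<open>v\<close>, with distinct labels. Going round the loop
    \<open>n\<close> times before leaving gives infinitely many walks from \<open>u\<close> to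
    \<open>v\<close>.\<close>
  define D :: "('v, 'e, 'l) database" where
    "D = \<lparr> Labels = {a, b}, Verts = {u, v}, Edges = {c, d}, Src = (\<lambda>e \<in> {c, d}. u),
           Tgt = (\<lambda>e \<in> {c, d}. if e = d then u else v),
           Lbl = (\<lambda>e \<in> {c, d}. if e = d then a else b) \<rparr>"
  have D: "is_database D"
    by (auto simp: is_database_def D_def PiE_iff)
  have inj: "inj_on (Lbl D) (Edges D)"
    using ab cd by (auto simp: D_def inj_on_def)
  define w where "w n = Walk u (replicate n (d, u) @ [(c, v)])" for n :: nat
  have walk: "w n \<in> db_walks D" for n
    unfolding w_def using cd by (induction n) (auto simp: D_def)
  have ends: "endpoints (w n) = (u, v)" for n
    by (simp add: w_def endpoints_def last_vertex_def)
  have "well_partial_order_on (db_walks D) (Restr r (db_walks D))"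
    using suit D by (simp add: suitable_def)
  then obtain i j where ij: "i < j" "(w i, w j) \<in> r"
    using walk unfolding well_partial_order_on_def by (metis IntD1 image_subsetI)
  have "w i = w j"
    using composable_order_incomparable[OF S D inj dot walk walk ends ends uv ij(2)] .
  then have "walk_length (w i) = walk_length (w j)" by simp
  then show False using ij(1) by (simp add: w_def)
qed

subsection \<open>Filter-based semantics\<close>

definition represents_filter :: "(('v, 'e) walk \<Rightarrow> bool) \<Rightarrow> ('v, 'e, 'l) semantics \<Rightarrow> bool" where
  "represents_filter f S \<longleftrightarrow> (\<forall>D R. is_database D \<longrightarrow> S D R = {w \<in> Matches D R. f w})"

lemma walk_append_in_db_walks:
  assumes "w \<in> db_walks D" "w' \<in> db_walks D" "last_vertex w = first_vertex w'"
  shows "walk_append w w' \<in> db_walks D"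
  using assms by (cases w; cases w') (simp add: walk_append_def db_walks_append)

lemma walk_append_simps [simp]:
  "first_vertex (walk_append w w') = first_vertex w"
  "walk_length (walk_append w w') = walk_length w + walk_length w'"
  "walk_label D (walk_append w w') = walk_label D w @ walk_label D w'"
  by (simp_all add: walk_append_def edges_def walk_length_def walk_label_def)

lemma last_vertex_walk_append [simp]:
  assumes "last_vertex w = first_vertex w'"
  shows "last_vertex (walk_append w w') = last_vertex w'"
  using assms by (cases w; cases w') (simp add: walk_append_def last_vertex_append)

text \<open>An accepted walk is a result for the expression of its own label. The conclusion does
  not mention \<open>D\<close>, so any database containing both walks will do.\<close>

lemma filter_walk_append:
  fixes S :: "('v, 'e, 'l) semantics" and D :: "('v, 'e, 'l) database"
  assumes f: "represents_filter f S" and D: "is_database D" and dot: "dot_composable S"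
    and "w \<in> db_walks D" "w' \<in> db_walks D" "f w" "f w'" "last_vertex w = first_vertex w'"
  shows "f (walk_append w w')"
proof -
  have "y \<in> S D (word_rexp (walk_label D y))" if "y \<in> db_walks D" "f y" for y
    using f D that by (simp add: represents_filter_def Matches_def)
  then have "walk_append w w' \<in>
      S D (Times (word_rexp (walk_label D w)) (word_rexp (walk_label D w')))"
    using dot_composableD[OF dot D] assms(4-) by blast
  then show ?thesis using f D by (simp add: represents_filter_def)
qed

lemma no_accepted_closed_walk:
  fixes S :: "('v, 'e, 'l) semantics" and D :: "('v, 'e, 'l) database"
  assumes S: "is_semantics S" and f: "represents_filter f S" and D: "is_database D"
    and dot: "dot_composable S"
    and w: "w \<in> db_walks D" "f w" "last_vertex w = first_vertex w"
  shows "walk_length w = 0"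
proof (rule ccontr)
  assume pos: "walk_length w \<noteq> 0"
  \<comment> \<open>\<open>p n\<close> is the power of \<open>w\<close> with exponent
    \<open>n + 1\<close>. The iteration starts from \<open>w\<close> because the filter might reject
    the trivial walk.\<close>
  define p where "p n = (walk_append w ^^ n) w" for n :: nat
  have p_Suc: "p (Suc n) = walk_append w (p n)" for n by (simp add: p_def)
  have p: "first_vertex (p n) = first_vertex w \<and> p n \<in> db_walks D \<and> f (p n) \<and>
      walk_length (p n) = Suc n * walk_length w \<and>
      walk_label D (p n) = concat (replicate (Suc n) (walk_label D w))" for n
  proof (induction n)
    case 0
    then show ?case using w by (simp add: p_def)
  next
    case (Suc n)
    then show ?case
      using w filter_walk_append[OF f D dot w(1) _ w(2)] walk_append_in_db_walks[OF w(1)]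
      by (simp add: p_Suc)
  qed
  let ?R = "Star (word_rexp (walk_label D w))"
  have "p n \<in> S D ?R" for n
  proof -
    have "concat (replicate (Suc n) (walk_label D w)) \<in> lang ?R"
      unfolding lang.simps lang_word_rexp mem_Collect_eq
      by (rule exI[of _ "replicate (Suc n) (walk_label D w)"]) auto
    then have "walk_label D (p n) \<in> lang ?R" using p[of n] by simp
    then show ?thesis
      using p[of n] f D unfolding represents_filter_def Matches_def by blast
  qed
  moreover have "finite (S D ?R)" using S D by (simp add: is_semantics_def)
  ultimately have "finite (range p)" by (meson finite_subset image_subsetI)
  moreover have "inj p"
  proof (rule injI)
    fix m n assume "p m = p n"
    then have "Suc m * walk_length w = Suc n * walk_length w" using p by metis
    then show "m = n" using pos by simp
  qed
  ultimately show False using finite_imageD by blast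
qed

section \<open>Fresh renamings and unions of databases\<close>

text \<open>The permutation is an involution that exchanges \<open>E\<close> with an equally large
  set \<open>F\<close> disjoint from it and fixes everything else.\<close>

lemma fresh_permutation:
  fixes E :: "'a set"
  assumes "finite E" "infinite (UNIV :: 'a set)"
  obtains \<nu> :: "'a \<Rightarrow> 'a" where "bij \<nu>" "\<nu> ` E \<inter> E = {}"
proof -
  have "infinite (- E)" using assms by (simp add: Compl_eq_Diff_UNIV)
  then obtain F where F: "F \<subseteq> - E" "finite F" "card F = card E"
    using infinite_arbitrarily_large by metis
  then obtain h where h: "bij_betw h E F"
    using finite_same_card_bij assms(1) by metis
  define \<nu> where "\<nu> x = (if x \<in> E then h x else if x \<in> F then inv_into E h x else x)" for x
  have hE: "h x \<in> F" "inv_into E h (h x) = x" if "x \<in> E" for x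
    using h that by (auto simp: bij_betw_def)
  have hF: "inv_into E h y \<in> E" "h (inv_into E h y) = y" if "y \<in> F" for y
    using h that by (auto simp: bij_betw_def inv_into_into f_inv_into_f)
  have disj: "y \<notin> E" if "y \<in> F" for y using F(1) that by auto
  have "\<nu> (\<nu> x) = x" for x
    by (cases "x \<in> E"; cases "x \<in> F") (simp_all add: \<nu>_def hE hF disj)
  then have "bij \<nu>" by (rule involuntory_imp_bij)
  moreover have "\<nu> ` E \<inter> E = {}"
    using hE by (auto simp: \<nu>_def dest: disj)
  ultimately show ?thesis by (rule that)
qed

text \<open>On common edges \<open>D\<close> takes precedence, so walks of \<open>D'\<close> survive
  when the edge sets are disjoint. Outside both edge sets the values are those of \<open>D'\<close>,
  which keeps the functions extensional.\<close>

definition merge_database ::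
    "('v, 'e, 'l) database \<Rightarrow> ('v, 'e, 'l) database \<Rightarrow> ('v, 'e, 'l) database" where
  "merge_database D D' =
     \<lparr> Labels = Labels D \<union> Labels D',
       Verts = Verts D \<union> Verts D',
       Edges = Edges D \<union> Edges D',
       Src = (\<lambda>e. if e \<in> Edges D then Src D e else Src D' e),
       Tgt = (\<lambda>e. if e \<in> Edges D then Tgt D e else Tgt D' e),
       Lbl = (\<lambda>e. if e \<in> Edges D then Lbl D e else Lbl D' e) \<rparr>"

lemma is_database_merge:
  assumes "is_database D" "is_database D'"
  shows "is_database (merge_database D D')"
  using assms by (auto simp: is_database_def merge_database_def PiE_iff extensional_def)

lemma filter_based_not_composable:
  fixes S :: "('v, 'e :: infinite, 'l) semantics"
  assumes S: "is_semantics S" and ind: "identifier_independent S"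
    and unb: "unbounded S" and filt: "filter_based S"
  shows "\<not> dot_composable S"
proof
  assume dot: "dot_composable S"
  obtain f where f: "represents_filter f S"
    using filt by (auto simp: filter_based_def represents_filter_def)
  obtain D R w where D: "is_database D" and wS: "w \<in> S D R" and len: "walk_length w \<ge> 1"
    using unb unfolding unbounded_def by (metis of_nat_1 of_nat_le_iff)
  have w: "w \<in> db_walks D" "f w"
    using wS f D by (auto simp: represents_filter_def Matches_def)
  have "finite (Edges D)" using D by (simp add: is_database_def)
  \<comment> \<open>Vertices stay shared so that the walks can meet, but an edge that kept its name
    could get different ends after the swap of vertices.\<close>
  then obtain \<nu>E where \<nu>E: "bij \<nu>E" "\<nu>E ` Edges D \<inter> Edges D = {}"
    using fresh_permutation infinite_UNIV by metis
  \<comment> \<open>The identity if \<open>w\<close> is closed, so that case needs no separate treatment.\<close>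
  define \<nu>V where "\<nu>V = id(first_vertex w := last_vertex w, last_vertex w := first_vertex w)"
  have "\<nu>V (\<nu>V x) = x" for x by (simp add: \<nu>V_def)
  then have \<nu>V: "bij \<nu>V" by (rule involuntory_imp_bij)
  define D' where "D' = rename_database \<nu>V \<nu>E D"
  define w' where "w' = map_walk \<nu>V \<nu>E w"
  have D': "is_database D'"
    unfolding D'_def using D \<nu>V \<nu>E(1) by (rule is_database_rename_database)
  have "w' \<in> S D' R"
    \<comment> \<open>Acceptance of \<open>w\<close> passes to \<open>w'\<close> through the
      semantics: the filter itself is not assumed invariant under renaming.\<close>
    using ind D \<nu>V \<nu>E(1) wS unfolding identifier_independent_def D'_def w'_def by blast
  then have w': "w' \<in> db_walks D'" "f w'"
    using f D' by (auto simp: represents_filter_def Matches_def)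
  have ends: "last_vertex w = first_vertex w'" "last_vertex w' = first_vertex w"
    by (auto simp: w'_def last_vertex_map_walk walk.map_sel \<nu>V_def)
  define M where "M = merge_database D D'"
  have M: "is_database M"
    unfolding M_def using D D' by (rule is_database_merge)
  have "db_walks D \<subseteq> db_walks M"
    by (rule db_walks_mono) (auto simp: M_def merge_database_def)
  moreover have "Edges D' \<inter> Edges D = {}"
    using \<nu>E(2) by (simp add: D'_def rename_database_def)
  then have "db_walks D' \<subseteq> db_walks M"
    by (intro db_walks_mono) (auto simp: M_def merge_database_def)
  ultimately have in_M: "w \<in> db_walks M" "w' \<in> db_walks M"
    using w(1) w'(1) by auto
  have "f (walk_append w w')"
    using filter_walk_append[OF f M dot in_M w(2) w'(2) ends(1)] .
  then have "walk_length (walk_append w w') = 0"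
    using walk_append_in_db_walks[OF in_M ends(1)] ends
    by (intro no_accepted_closed_walk[OF S f M dot]) simp_all
  then show False using len by simp
qed

theorem lemma44:
  fixes S :: "('v :: {countable, infinite}, 'e :: {countable, infinite}, 'l :: {countable, infinite}) semantics"
  shows "(is_semantics S \<and> order_based S \<longrightarrow> \<not> dot_composable S) \<and>
    (is_semantics S \<and> identifier_independent S \<and> unbounded S \<and> filter_based S \<longrightarrow>
       \<not> dot_composable S)"
  using order_based_not_composable filter_based_not_composable by blast

end
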